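(* Let $\mathfrak H$ be a Krein space and let $\mathfrak L$, $\mathcal H$ be Hilbert spaces. Let $T$ be a closed symmetric linear relation in $\mathfrak H$, let $\Pi_\Gamma=(\mathfrak L,\Gamma_0,\Gamma_1)$ be an isometric boundary triple for $T^+$ with Weyl family $M_\Gamma$. Assume that $\ker\Gamma=T$ and that $T_0:=\ker\Gamma_0$ is self-adjoint. Define $\Gamma':=V\Gamma$, where $V$ is an injective isometric operator from the $\widehat J^\circ_{\mathfrak L}$-space $\mathfrak L^2$ to the $\widehat J^\circ_{\mathcal H}$-space $\mathcal H^2$ such that: (a) $\Gamma_1(T_0)\subseteq\operatorname{mul}\operatorname{dom}V$, (b) $V(\operatorname{ran}\Gamma)$ is dense in $\mathcal H^2$, (c) $T_0'=T_0$, where $T'_0:=\ker\Gamma'_0$. Then $\Pi_{\Gamma'}=(\mathcal H,\Gamma'_0,\Gamma'_1)$ is an isometric boundary triple for $T^+$ such that $\ker\Gamma'=T$. The corresponding Weyl family is $$M_{\Gamma'}(z)=V(M_\Gamma(z)),\quad z\in\mathbb C_*.$$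
   Context: Linear relations: a relation from a linear space $X$ to a linear space $Y$ is a linear subset $R\subseteq X\times Y$ (a relation in $X$ if $X=Y$); operators (not necessarily bounded, everywhere or densely defined) are identified with their graphs. $\operatorname{dom}R,\operatorname{ran}R$ are the domain and range, $\ker R=\{x:(x,0)\in R\}$, $\operatorname{mul}R=\{y:(0,y)\in R\}$, $R^{-1}=\{(y,x):(x,y)\in R\}$, $R(S)=\{y:\exists x\in S,\ (x,y)\in R\}$; $QR=\{(x,w):\exists y,\ (x,y)\in R,(y,w)\in Q\}$. Since $\operatorname{dom}V\subseteq\mathfrak L^2$ is itself a relation in $\mathfrak L$, $\operatorname{mul}\operatorname{dom}V=\{l'\in\mathfrak L:(0,l')\in\operatorname{dom}V\}$. $\mathbb C_*=\mathbb C\setminus\mathbb R$. Krein space: a Hilbert space $(\mathfrak H,\langle\cdot,\cdot\rangle)$ with a fundamental symmetry $J=J^*=J^{-1}$ and indefinite metric $[f,g]=\langle f,Jg\rangle$. The adjoint of a relation $T$ in $\mathfrak H$ is $T^+=\{(g,g')\in\mathfrak H^2:[f',g]=[f,g']\ \forall(f,f')\in T\}$; $T$ is symmetric if $T\subseteq T^+$, self-adjoint if $T=T^+$. $\mathfrak H^2$ carries the fundamental symmetry $\widehat J_{\mathfrak H}=\begin{pmatrix}0&-iJ\\ iJ&0\end{pmatrix}$; for a Hilbert space $\mathfrak L$, $\mathfrak L^2$ carries $\widehat J^\circ_{\mathfrak L}=\begin{pmatrix}0&-iI\\ iI&0\end{pmatrix}$ (similarly $\mathcal H$). For a relation $R$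 between two such spaces, from one with fundamental symmetry $j_1$ to one with fundamental symmetry $j_2$, put $R^+=j_1R^*j_2$ ($R^*$ the Hilbert space adjoint) and $R_\#=(R^+)^{-1}$; $R$ is isometric if $R\subseteq R_\#$. For a closed symmetric relation $T$ in $\mathfrak H$, $(\mathfrak L,\Gamma)$ with $\Gamma\subseteq\mathfrak H^2\times\mathfrak L^2$ is an isometric boundary pair for $T^+$ if $\Gamma$ is isometric and $T=\ker\Gamma_\#$. For a relation $\Gamma$, $\Gamma_0=\{(\widehat f,l):(\widehat f,(l,l'))\in\Gamma\}$, $\Gamma_1=\{(\widehat f,l'):(\widehat f,(l,l'))\in\Gamma\}$. If $\Gamma$ is an operator, the isometric boundary pair is called an isometric boundary triple for $T^+$ and written $(\mathfrak L,\Gamma_0,\Gamma_1)$; then $\Gamma\widehat f=(\Gamma_0\widehat f,\Gamma_1\widehat f)$, $\widehat f\in\operatorname{dom}\Gamma$. The Weyl family is $M_\Gamma(z)=\{\widehat l\in\mathfrak L^2:\exists f\in\mathfrak H,\ ((f,zf),\widehat l)\in\Gamma\}$, $z\in\mathbb C_*$. The same definitions apply to $\Gamma'$ with $\mathcal H$ in place of $\mathfrak L$. *)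

theory Defs
  imports "HOL-Analysis.Analysis"
begin

section \<open>Complex Hilbert spaces\<close>

text \<open>
  The inner product is conjugate-linear in its first argument. Completeness and the topology come
  from \<^class>\<open>banach\<close>; the last axiom says that the norm is the one induced by the
  inner product, so positive definiteness of the inner product follows from that of the norm.
\<close>

class complex_hilbert_space = banach +
  fixes scaleC :: "complex \<Rightarrow> 'a \<Rightarrow> 'a"  (infixr "*\<^sub>C" 75)
    and cinner :: "'a \<Rightarrow> 'a \<Rightarrow> complex"
  assumes scaleC_add_right: "a *\<^sub>C (x + y) = a *\<^sub>C x + a *\<^sub>C y"
    and scaleC_add_left: "(a + b) *\<^sub>C x = a *\<^sub>C x + b *\<^sub>C x"
    and scaleC_scaleC: "a *\<^sub>C (b *\<^sub>C x) = (a * b) *\<^sub>C x"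
    and scaleC_of_real: "of_real r *\<^sub>C x = r *\<^sub>R x"
    and cinner_commute: "cinner x y = cnj (cinner y x)"
    and cinner_add_right: "cinner x (y + z) = cinner x y + cinner x z"
    and cinner_scaleC_right: "cinner x (a *\<^sub>C y) = a * cinner x y"
    and norm_cinner: "cinner x x = of_real ((norm x)\<^sup>2)"

lemma scaleC_one: "1 *\<^sub>C x = (x :: 'a::complex_hilbert_space)"
  using scaleC_of_real[of 1 x] by simp

interpretation complex_vector:
  vector_space "scaleC :: complex \<Rightarrow> 'a \<Rightarrow> 'a::complex_hilbert_space"
  by standard (simp_all add: scaleC_add_right scaleC_add_left scaleC_scaleC scaleC_one)

lemma cinner_add_left: "cinner (x + y) z = cinner x z + cinner y z"
  by (metis cinner_commute cinner_add_right complex_cnj_add)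

lemma cinner_scaleC_left: "cinner (a *\<^sub>C x) y = cnj a * cinner x y"
  by (metis cinner_commute cinner_scaleC_right complex_cnj_mult)

instantiation complex :: complex_hilbert_space
begin

definition scaleC_complex :: "complex \<Rightarrow> complex \<Rightarrow> complex"
  where "scaleC_complex a x = a * x"

definition cinner_complex :: "complex \<Rightarrow> complex \<Rightarrow> complex"
  where "cinner_complex x y = cnj x * y"

instance
proof
  fix x :: complex
  show "cinner x x = of_real ((norm x)\<^sup>2)"
    by (metis cinner_complex_def complex_norm_square mult.commute)
qed (simp_all add: scaleC_complex_def cinner_complex_def scaleR_conv_of_real algebra_simps)

end

instantiation prod :: (complex_hilbert_space, complex_hilbert_space) complex_hilbert_space
begin

definition scaleC_prod :: "complex \<Rightarrow> 'a \<times> 'b \<Rightarrow> 'a \<times> 'b"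
  where "scaleC_prod a x = (a *\<^sub>C fst x, a *\<^sub>C snd x)"

definition cinner_prod :: "'a \<times> 'b \<Rightarrow> 'a \<times> 'b \<Rightarrow> complex"
  where "cinner_prod x y = cinner (fst x) (fst y) + cinner (snd x) (snd y)"

instance
proof
  fix x y :: "'a \<times> 'b"
  show "cinner x y = cnj (cinner y x)"
    unfolding cinner_prod_def
    by (metis cinner_commute complex_cnj_add)
  show "cinner x x = of_real ((norm x)\<^sup>2)"
    by (simp add: cinner_prod_def norm_cinner norm_prod_def)
qed (simp_all add: scaleC_prod_def cinner_prod_def scaleC_add_right scaleC_add_left
       scaleC_scaleC scaleC_of_real cinner_add_right cinner_scaleC_right scaleR_prod_def algebra_simps)

end


section \<open>Linear relations\<close>

text \<open>
  Relations are sets of pairs. Domain, range, inverse and image are those of the library; the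
  product written \<open>Q R\<close> on paper is \<^term>\<open>R O Q\<close>. A linear relation is (the graph of) an
  operator iff it is \<^const>\<open>single_valued\<close>, and an operator is injective iff its converse
  is \<^const>\<open>single_valued\<close>.
\<close>

definition linear_relation :: "('a::complex_hilbert_space \<times> 'b::complex_hilbert_space) set \<Rightarrow> bool"
  where "linear_relation R \<longleftrightarrow> complex_vector.subspace R"

definition rel_ker :: "('a \<times> 'b::zero) set \<Rightarrow> 'a set"
  where "rel_ker R = {x. (x, 0) \<in> R}"

definition rel_mul :: "('a::zero \<times> 'b) set \<Rightarrow> 'b set"
  where "rel_mul R = {y. (0, y) \<in> R}"

definition op_graph :: "('a \<Rightarrow> 'b) \<Rightarrow> ('a \<times> 'b) set"
  where "op_graph f = {(x, y). y = f x}"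

definition hilbert_adjoint ::
  "('a::complex_hilbert_space \<times> 'b::complex_hilbert_space) set \<Rightarrow> ('b \<times> 'a) set"
  where "hilbert_adjoint R = {(y, x). \<forall>(u, v) \<in> R. cinner v y = cinner u x}"


section \<open>Krein spaces\<close>

text \<open>
  The equations \<open>J = J\<^sup>* = J\<^sup>-\<^sup>1\<close> are equations between graphs. As \<open>J\<close> is defined on the whole
  space, they make it linear and isometric, hence bounded.
\<close>

definition fundamental_symmetry :: "('a::complex_hilbert_space \<Rightarrow> 'a) \<Rightarrow> bool"
  where "fundamental_symmetry J \<longleftrightarrow>
    op_graph J = hilbert_adjoint (op_graph J) \<and> op_graph J = (op_graph J)\<inverse>"

lemma cinner_ext:
  fixes x y :: "'a::complex_hilbert_space"
  assumes "\<And>u. cinner u x = cinner u y"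
  shows "x = y"
proof -
  have "cinner (x - y) ((x - y) + y) = cinner (x - y) (x - y) + cinner (x - y) y"
    by (rule cinner_add_right)
  then have "cinner (x - y) (x - y) = 0"
    using assms[of "x - y"] by simp
  then show ?thesis
    by (simp add: norm_cinner)
qed

lemma fundamental_symmetry_iff:
  "fundamental_symmetry J \<longleftrightarrow>
    (\<forall>x y. cinner (J x) y = cinner x (J y)) \<and> (\<forall>x. J (J x) = x)"
proof
  assume J: "fundamental_symmetry J"
  have "(y, J y) \<in> hilbert_adjoint (op_graph J)" for y
    using J by (auto simp: fundamental_symmetry_def op_graph_def)
  moreover have "(J x, x) \<in> op_graph J" for x
    using J by (auto simp: fundamental_symmetry_def op_graph_def)
  ultimately show "(\<forall>x y. cinner (J x) y = cinner x (J y)) \<and> (\<forall>x. J (J x) = x)"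
    by (auto simp: hilbert_adjoint_def op_graph_def)
next
  assume J: "(\<forall>x y. cinner (J x) y = cinner x (J y)) \<and> (\<forall>x. J (J x) = x)"
  have "(\<forall>u. cinner (J u) y = cinner u x) \<longleftrightarrow> x = J y" for x y
    using J cinner_ext[of "J y" x] by auto
  then have "op_graph J = hilbert_adjoint (op_graph J)"
    by (simp add: hilbert_adjoint_def op_graph_def)
  moreover have "op_graph J = (op_graph J)\<inverse>"
    using J by (auto simp: op_graph_def)
  ultimately show "fundamental_symmetry J"
    by (simp add: fundamental_symmetry_def)
qed

definition krein_inner :: "('a::complex_hilbert_space \<Rightarrow> 'a) \<Rightarrow> 'a \<Rightarrow> 'a \<Rightarrow> complex"
  where "krein_inner J f g = cinner f (J g)"

definition krein_adjoint :: "('a::complex_hilbert_space \<Rightarrow> 'a) \<Rightarrow> ('a \<times> 'a) set \<Rightarrow> ('a \<times> 'a) set"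
  where "krein_adjoint J T =
    {(g, g'). \<forall>(f, f') \<in> T. krein_inner J f' g = krein_inner J f g'}"

definition krein_symmetric :: "('a::complex_hilbert_space \<Rightarrow> 'a) \<Rightarrow> ('a \<times> 'a) set \<Rightarrow> bool"
  where "krein_symmetric J T \<longleftrightarrow> T \<subseteq> krein_adjoint J T"

definition krein_self_adjoint :: "('a::complex_hilbert_space \<Rightarrow> 'a) \<Rightarrow> ('a \<times> 'a) set \<Rightarrow> bool"
  where "krein_self_adjoint J T \<longleftrightarrow> T = krein_adjoint J T"

text \<open>
  \<open>hat_sym J\<close> is the operator matrix with rows \<open>(0, -\<i>J)\<close> and \<open>(\<i>J, 0)\<close>; on the square of a
  Hilbert space the relevant symmetry is \<open>hat_sym id\<close>.
\<close>

definition hat_sym :: "('a::complex_hilbert_space \<Rightarrow> 'a) \<Rightarrow> 'a \<times> 'a \<Rightarrow> 'a \<times> 'a"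
  where "hat_sym J = (\<lambda>(f, f'). ((- \<i>) *\<^sub>C J f', \<i> *\<^sub>C J f))"

lemma fundamental_symmetry_id: "fundamental_symmetry id"
  by (simp add: fundamental_symmetry_iff)

lemma fundamental_symmetry_hat_sym:
  assumes "fundamental_symmetry J"
  shows "fundamental_symmetry (hat_sym J)"
proof -
  have sa: "cinner (J x) y = cinner x (J y)" and inv: "J (J x) = x" for x y
    using assms by (auto simp: fundamental_symmetry_iff)
  have scale: "J (a *\<^sub>C x) = a *\<^sub>C J x" for a x
  proof (rule cinner_ext)
    show "cinner u (J (a *\<^sub>C x)) = cinner u (a *\<^sub>C J x)" for u
      using sa[of u "a *\<^sub>C x"] sa[of u x] by (metis cinner_scaleC_right)
  qed
  show ?thesis
    by (auto simp: fundamental_symmetry_iff hat_sym_def cinner_prod_def sa inv scale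
        cinner_scaleC_left cinner_scaleC_right scaleC_scaleC scaleC_one
        simp del: complex_vector.scale_minus_left)
qed

definition rel_plus ::
  "('a::complex_hilbert_space \<Rightarrow> 'a) \<Rightarrow> ('b::complex_hilbert_space \<Rightarrow> 'b) \<Rightarrow>
    ('a \<times> 'b) set \<Rightarrow> ('b \<times> 'a) set"
  where "rel_plus j\<^sub>1 j\<^sub>2 R = op_graph j\<^sub>2 O hilbert_adjoint R O op_graph j\<^sub>1"

definition rel_sharp ::
  "('a::complex_hilbert_space \<Rightarrow> 'a) \<Rightarrow> ('b::complex_hilbert_space \<Rightarrow> 'b) \<Rightarrow>
    ('a \<times> 'b) set \<Rightarrow> ('a \<times> 'b) set"
  where "rel_sharp j\<^sub>1 j\<^sub>2 R = (rel_plus j\<^sub>1 j\<^sub>2 R)\<inverse>"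

definition isometric_relation ::
  "('a::complex_hilbert_space \<Rightarrow> 'a) \<Rightarrow> ('b::complex_hilbert_space \<Rightarrow> 'b) \<Rightarrow>
    ('a \<times> 'b) set \<Rightarrow> bool"
  where "isometric_relation j\<^sub>1 j\<^sub>2 R \<longleftrightarrow> R \<subseteq> rel_sharp j\<^sub>1 j\<^sub>2 R"


section \<open>Isometric boundary pairs and triples\<close>

text \<open>
  A boundary pair or triple is one for the adjoint of \<open>T\<close>, but the definition refers to the closed
  symmetric relation \<open>T\<close> itself, which is therefore the parameter. The boundary space is the type \<open>'l\<close>.
\<close>

definition isometric_boundary_pair ::
  "('h::complex_hilbert_space \<Rightarrow> 'h) \<Rightarrow> ('h \<times> 'h) set \<Rightarrow>
    (('h \<times> 'h) \<times> ('l::complex_hilbert_space \<times> 'l)) set \<Rightarrow> bool"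
  where "isometric_boundary_pair J T \<Gamma> \<longleftrightarrow>
    linear_relation T \<and> closed T \<and> krein_symmetric J T \<and>
    linear_relation \<Gamma> \<and>
    isometric_relation (hat_sym J) (hat_sym id) \<Gamma> \<and>
    T = rel_ker (rel_sharp (hat_sym J) (hat_sym id) \<Gamma>)"

definition isometric_boundary_triple ::
  "('h::complex_hilbert_space \<Rightarrow> 'h) \<Rightarrow> ('h \<times> 'h) set \<Rightarrow>
    (('h \<times> 'h) \<times> ('l::complex_hilbert_space \<times> 'l)) set \<Rightarrow> bool"
  where "isometric_boundary_triple J T \<Gamma> \<longleftrightarrow>
    isometric_boundary_pair J T \<Gamma> \<and> single_valued \<Gamma>"

definition component\<^sub>0 :: "('a \<times> ('l \<times> 'l)) set \<Rightarrow> ('a \<times> 'l) set"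
  where "component\<^sub>0 \<Gamma> = {(f, l). \<exists>l'. (f, (l, l')) \<in> \<Gamma>}"

definition component\<^sub>1 :: "('a \<times> ('l \<times> 'l)) set \<Rightarrow> ('a \<times> 'l) set"
  where "component\<^sub>1 \<Gamma> = {(f, l'). \<exists>l. (f, (l, l')) \<in> \<Gamma>}"

definition weyl_family ::
  "(('h::complex_hilbert_space \<times> 'h) \<times> ('l \<times> 'l)) set \<Rightarrow> complex \<Rightarrow> ('l \<times> 'l) set"
  where "weyl_family \<Gamma> z = {l. \<exists>f. ((f, z *\<^sub>C f), l) \<in> \<Gamma>}"

end

theory Submission
  imports Defs
begin

text \<open>
  The kernel of \<open>\<Gamma>'\<^sub>#\<close> is the Krein adjoint of \<open>dom \<Gamma>'\<close>. As \<open>dom \<Gamma>'\<close> lies between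
  \<open>T\<^sub>0' = T\<^sub>0\<close> and \<open>dom \<Gamma>\<close>, this adjoint contains \<open>T\<close> and is contained in the self-adjoint
  relation \<open>T\<^sub>0'\<close>. For \<open>g\<close> in it, Green's identity makes \<open>\<Gamma>' g = (0, k')\<close> orthogonal, in the
  indefinite metric, to \<open>ran \<Gamma>'\<close>, which is dense; so \<open>\<Gamma>' g = 0\<close>, and the injectivity of \<open>V\<close>
  puts \<open>g\<close> into \<open>ker \<Gamma> = T\<close>.
\<close>

lemma cinner_zero_right [simp]: "cinner x 0 = (0 :: complex)" for x :: "'a::complex_hilbert_space"
  using cinner_add_right[of x 0 0] by simp

lemma norm_diff_orthogonal:
  fixes x y :: "'a::complex_hilbert_space"
  assumes "cinner y x = 0"
  shows "(norm (x - y))\<^sup>2 = (norm x)\<^sup>2 + (norm y)\<^sup>2"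
proof -
  have xy: "cinner x y = 0"
    using assms cinner_commute[of x y] by simp
  have sub: "cinner u (v - w) = cinner u v - cinner u w" for u v w :: 'a
    using cinner_add_right[of u "v - w" w] by simp
  have subl: "cinner (u - v) w = cinner u w - cinner v w" for u v w :: 'a
    using cinner_add_left[of "u - v" v w] by simp
  have "cinner (x - y) (x - y) = cinner x x + cinner y y"
    by (simp add: sub subl assms xy)
  then have "complex_of_real ((norm (x - y))\<^sup>2) = of_real ((norm x)\<^sup>2 + (norm y)\<^sup>2)"
    by (simp add: norm_cinner)
  then show ?thesis
    by (simp only: of_real_eq_iff)
qed

text \<open>By Pythagoras, no element of \<open>D\<close> lies closer to \<open>x\<close> than
  \<open>norm x\<close>, so density leaves only \<open>x = 0\<close>. This works directly with the
  approximating element, without continuity of the inner product.\<close>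

lemma orthogonal_dense_zero:
  fixes x :: "'a::complex_hilbert_space"
  assumes dense: "closure D = UNIV" and orth: "\<And>d. d \<in> D \<Longrightarrow> cinner d x = 0"
  shows "x = 0"
proof (rule ccontr)
  assume "x \<noteq> 0"
  then obtain d where d: "d \<in> D" "dist d x < norm x"
    using dense closure_approachable[of x D] by (metis UNIV_I zero_less_norm_iff)
  have "(norm x)\<^sup>2 \<le> (norm (x - d))\<^sup>2"
    using norm_diff_orthogonal[OF orth[OF d(1)]] by simp
  then have "norm x \<le> norm (x - d)"
    by (rule power2_le_imp_le) simp
  with d(2) show False
    by (simp add: dist_norm norm_minus_commute)
qed

text \<open>Since \<open>j\<^sub>1\<close> is an involution, it can be moved to the other side of
  the equation. What remains is an abstract Green identity of the pair against all of
  \<open>R\<close>.\<close>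

lemma rel_sharp_iff:
  assumes "fundamental_symmetry j\<^sub>1"
  shows "(x, y) \<in> rel_sharp j\<^sub>1 j\<^sub>2 R \<longleftrightarrow> (\<forall>(u, v) \<in> R. cinner v (j\<^sub>2 y) = cinner u (j\<^sub>1 x))"
proof -
  have inv: "x = j\<^sub>1 w \<longleftrightarrow> w = j\<^sub>1 x" for w
    using assms by (auto simp: fundamental_symmetry_iff)
  show ?thesis
    by (auto simp: rel_sharp_def rel_plus_def relcomp_unfold op_graph_def hilbert_adjoint_def inv)
qed

text \<open>Linearity of \<open>J\<close> is not part of its definition; moving \<open>J\<close> to
  the other argument of the inner product replaces it.\<close>

lemma fundamental_symmetry_zero:
  assumes "fundamental_symmetry J"
  shows "J 0 = 0"
proof (rule cinner_ext)
  show "cinner u (J 0) = cinner u 0" for u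
    using assms by (metis fundamental_symmetry_iff cinner_zero_right)
qed

text \<open>The two Green identities chain through the common middle term formed with
  \<open>j\<^sub>2\<close>.\<close>

lemma isometric_relation_comp:
  assumes j: "fundamental_symmetry j\<^sub>1" "fundamental_symmetry j\<^sub>2"
    and R: "isometric_relation j\<^sub>1 j\<^sub>2 R" and S: "isometric_relation j\<^sub>2 j\<^sub>3 S"
  shows "isometric_relation j\<^sub>1 j\<^sub>3 (R O S)"
proof -
  have R': "cinner v (j\<^sub>2 y) = cinner u (j\<^sub>1 x)" if "(x, y) \<in> R" "(u, v) \<in> R" for x y u v
    using R that unfolding isometric_relation_def by (fastforce simp: rel_sharp_iff[OF j(1)])
  have S': "cinner v (j\<^sub>3 y) = cinner u (j\<^sub>2 x)" if "(x, y) \<in> S" "(u, v) \<in> S" for x y u v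
    using S that unfolding isometric_relation_def by (fastforce simp: rel_sharp_iff[OF j(2)])
  show ?thesis
    unfolding isometric_relation_def
  proof clarify
    fix x y z assume *: "(x, y) \<in> R" "(y, z) \<in> S"
    show "(x, z) \<in> rel_sharp j\<^sub>1 j\<^sub>3 (R O S)"
      using R'[OF *(1)] S'[OF *(2)] by (auto simp: rel_sharp_iff[OF j(1)])
  qed
qed

lemma linear_relation_comp:
  assumes "linear_relation R" and "linear_relation S"
  shows "linear_relation (R O S)"
  unfolding linear_relation_def complex_vector.subspace_def
proof (intro conjI ballI allI)
  note R = assms(1)[unfolded linear_relation_def]
    and S = assms(2)[unfolded linear_relation_def]
  show "0 \<in> R O S"
    using complex_vector.subspace_0[OF R] complex_vector.subspace_0[OF S]
    by (auto simp: zero_prod_def)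
  show "p + q \<in> R O S" if "p \<in> R O S" "q \<in> R O S" for p q
    using that complex_vector.subspace_add[OF R] complex_vector.subspace_add[OF S]
    by (fastforce simp: plus_prod_def)
  show "c *\<^sub>C p \<in> R O S" if "p \<in> R O S" for c p
    using that complex_vector.subspace_scale[OF R] complex_vector.subspace_scale[OF S]
    by (fastforce simp: scaleC_prod_def)
qed

text \<open>The metric given by \<open>hat_sym J\<close> is \<open>\<i>\<close> times the difference
  of the two Krein products that the adjoint equates. The adjoint is thus an orthogonal
  companion.\<close>

lemma krein_adjoint_iff:
  "g \<in> krein_adjoint J T \<longleftrightarrow> (\<forall>f \<in> T. cinner f (hat_sym J g) = 0)"
proof -
  have "cinner (f, f') (hat_sym J (g\<^sub>1, g\<^sub>2)) = \<i> * (cinner f' (J g\<^sub>1) - cinner f (J g\<^sub>2))" for f f' g\<^sub>1 g\<^sub>2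
    unfolding hat_sym_def cinner_prod_def by (simp only: prod.case fst_conv snd_conv cinner_scaleC_right) algebra
  then show ?thesis
    by (cases g) (auto simp: krein_adjoint_def krein_inner_def)
qed

text \<open>With second component 0, one side of the Green identity vanishes because
  \<open>j 0 = 0\<close>; the other expresses orthogonality to the domain.\<close>

lemma rel_ker_rel_sharp:
  assumes J: "fundamental_symmetry J" and j: "fundamental_symmetry j"
  shows "rel_ker (rel_sharp (hat_sym J) j \<Gamma>) = krein_adjoint J (Domain \<Gamma>)"
  by (fastforce simp: rel_ker_def krein_adjoint_iff fundamental_symmetry_zero[OF j]
      rel_sharp_iff[OF fundamental_symmetry_hat_sym[OF J]])

lemma krein_adjoint_antimono: "S \<subseteq> T \<Longrightarrow> krein_adjoint J T \<subseteq> krein_adjoint J S"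
  by (meson krein_adjoint_iff subset_iff)

lemma krein_adjoint_Domain_subset_rel_ker:
  assumes J: "fundamental_symmetry J" and j: "fundamental_symmetry j"
    and iso: "isometric_relation (hat_sym J) j \<Gamma>" and dense: "closure (Range \<Gamma>) = UNIV"
    and sub: "krein_adjoint J (Domain \<Gamma>) \<subseteq> Domain \<Gamma>"
  shows "krein_adjoint J (Domain \<Gamma>) \<subseteq> rel_ker \<Gamma>"
proof
  fix g assume g: "g \<in> krein_adjoint J (Domain \<Gamma>)"
  then obtain k where k: "(g, k) \<in> \<Gamma>"
    using sub by auto
  then have "(g, k) \<in> rel_sharp (hat_sym J) j \<Gamma>"
    using iso by (auto simp: isometric_relation_def)
  \<comment> \<open>If \<open>(u, l)\<close> is in \<open>\<Gamma>\<close>, this product equals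
    \<open>cinner u (hat_sym J g)\<close>, which is zero by the choice of \<open>g\<close>.\<close>
  then have "cinner l (j k) = 0" if "l \<in> Range \<Gamma>" for l
    using that g by (fastforce simp: krein_adjoint_iff rel_sharp_iff[OF fundamental_symmetry_hat_sym[OF J]])
  then have "j k = 0"
    by (rule orthogonal_dense_zero[OF dense])
  then have "k = 0"
    using j fundamental_symmetry_zero[OF j] by (metis fundamental_symmetry_iff)
  with k show "g \<in> rel_ker \<Gamma>"
    by (simp add: rel_ker_def)
qed

theorem lemma7p7:
  fixes J :: "'h::complex_hilbert_space \<Rightarrow> 'h"
    and T T\<^sub>0 T\<^sub>0' :: "('h \<times> 'h) set"
    and \<Gamma> :: "(('h \<times> 'h) \<times> ('l::complex_hilbert_space \<times> 'l)) set"
    and V :: "(('l \<times> 'l) \<times> ('k::complex_hilbert_space \<times> 'k)) set"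
    and \<Gamma>' :: "(('h \<times> 'h) \<times> ('k \<times> 'k)) set"
  assumes "fundamental_symmetry J"
    and "linear_relation T" and "closed T" and "krein_symmetric J T"
    and "isometric_boundary_triple J T \<Gamma>"
    and "rel_ker \<Gamma> = T"
    and "T\<^sub>0 = rel_ker (component\<^sub>0 \<Gamma>)"
    and "krein_self_adjoint J T\<^sub>0"
    and "linear_relation V" and "single_valued V" and "single_valued (V\<inverse>)"
    and "isometric_relation (hat_sym id) (hat_sym id) V"
    and "\<Gamma>' = \<Gamma> O V"
    and a: "component\<^sub>1 \<Gamma> `` T\<^sub>0 \<subseteq> rel_mul (Domain V)"
    and b: "closure (V `` Range \<Gamma>) = UNIV"
    and "T\<^sub>0' = rel_ker (component\<^sub>0 \<Gamma>')"
    and c: "T\<^sub>0' = T\<^sub>0"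
  shows "isometric_boundary_triple J T \<Gamma>' \<and>
    rel_ker \<Gamma>' = T \<and>
    (\<forall>z. z \<notin> \<real> \<longrightarrow> weyl_family \<Gamma>' z = V `` weyl_family \<Gamma> z)"
proof -
  note J = \<open>fundamental_symmetry J\<close>
  note j = fundamental_symmetry_hat_sym[OF fundamental_symmetry_id]
  have \<Gamma>: "linear_relation \<Gamma>" "single_valued \<Gamma>" "isometric_relation (hat_sym J) (hat_sym id) \<Gamma>"
    and T: "T = krein_adjoint J (Domain \<Gamma>)"
    using \<open>isometric_boundary_triple J T \<Gamma>\<close>
    by (auto simp: isometric_boundary_triple_def isometric_boundary_pair_def rel_ker_rel_sharp[OF J j])
  have V0: "(0, 0) \<in> V"
    using complex_vector.subspace_0 \<open>linear_relation V\<close>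
    by (fastforce simp: linear_relation_def zero_prod_def)
  \<comment> \<open>If \<open>V\<close> relates \<open>l\<close> to 0, then \<open>l = 0\<close>,
    since \<open>V\<close> is injective and also relates 0 to 0.\<close>
  have ker: "rel_ker \<Gamma>' = T"
    using V0 \<open>single_valued (V\<inverse>)\<close> \<open>rel_ker \<Gamma> = T\<close> unfolding \<open>\<Gamma>' = \<Gamma> O V\<close>
    by (auto simp: rel_ker_def dest: single_valuedD)
  have iso: "isometric_relation (hat_sym J) (hat_sym id) \<Gamma>'"
    unfolding \<open>\<Gamma>' = \<Gamma> O V\<close>
    using fundamental_symmetry_hat_sym[OF J] j \<Gamma>(3)
      \<open>isometric_relation (hat_sym id) (hat_sym id) V\<close>
    by (rule isometric_relation_comp)
  have dom: "T\<^sub>0 \<subseteq> Domain \<Gamma>'"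
    using \<open>T\<^sub>0' = rel_ker (component\<^sub>0 \<Gamma>')\<close> c by (auto simp: rel_ker_def component\<^sub>0_def)
  \<comment> \<open>Adjoints reverse inclusions and \<open>T\<^sub>0\<close> is its own adjoint.
    With \<open>dom\<close>, this places the adjoint inside \<open>Domain \<Gamma>'\<close>, so its
    elements have boundary values.\<close>
  have "krein_adjoint J (Domain \<Gamma>') \<subseteq> T\<^sub>0"
    using krein_adjoint_antimono[OF dom] \<open>krein_self_adjoint J T\<^sub>0\<close>
    by (auto simp: krein_self_adjoint_def)
  moreover have "Range \<Gamma>' = V `` Range \<Gamma>"
    unfolding \<open>\<Gamma>' = \<Gamma> O V\<close> by blast
  then have "closure (Range \<Gamma>') = UNIV"
    using b by simp
  ultimately have "krein_adjoint J (Domain \<Gamma>') \<subseteq> T"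
    using krein_adjoint_Domain_subset_rel_ker[OF J j iso] dom ker by blast
  \<comment> \<open>Composing with \<open>V\<close> can only shrink the domain, hence only enlarge
    the adjoint.\<close>
  moreover have "T \<subseteq> krein_adjoint J (Domain \<Gamma>')"
    unfolding T by (rule krein_adjoint_antimono) (auto simp: \<open>\<Gamma>' = \<Gamma> O V\<close>)
  ultimately have "T = rel_ker (rel_sharp (hat_sym J) (hat_sym id) \<Gamma>')"
    by (simp add: rel_ker_rel_sharp[OF J j] antisym)
  moreover have "linear_relation \<Gamma>'" "single_valued \<Gamma>'"
    unfolding \<open>\<Gamma>' = \<Gamma> O V\<close>
    using \<Gamma>(1,2) \<open>linear_relation V\<close> \<open>single_valued V\<close>
    by (auto intro: linear_relation_comp single_valued_relcomp)
  ultimately have "isometric_boundary_triple J T \<Gamma>'"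
    using iso \<open>linear_relation T\<close> \<open>closed T\<close> \<open>krein_symmetric J T\<close>
    by (simp add: isometric_boundary_triple_def isometric_boundary_pair_def)
  moreover have "weyl_family \<Gamma>' z = V `` weyl_family \<Gamma> z" for z
    by (auto simp: weyl_family_def \<open>\<Gamma>' = \<Gamma> O V\<close>)
  ultimately show ?thesis
    using ker by simp
qed

end
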